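(* For all integers $k,n\ge 1$, $$\phi(k,n;\Gamma,C)=2^{k+n-1}.$$ Consequently, as formal power series, $$\Phi(x,y;\Gamma,C)=1+\tfrac12(e^{2x}-1)(e^{2y}-1),\qquad \Phi(z;\Gamma,C)=\tfrac12(e^{4z}+1).$$
   Context: A $(0,1)$-matrix is a matrix with all entries in $\{0,1\}$. A $2\times2$ submatrix of a matrix is obtained by choosing two rows $i_1<i_2$ and two columns $j_1<j_2$. Let $\Gamma=\begin{pmatrix}1&1\\1&0\end{pmatrix}$ and $C=\begin{pmatrix}1&0\\0&0\end{pmatrix}$. For a $2\times2$ $(0,1)$-matrix $P$, let $[P]$ be its equivalence class under row exchanges and column exchanges; thus $[\Gamma]$ (resp. $[C]$) consists of the four $2\times2$ $(0,1)$-matrices with exactly three (resp. exactly one) entries equal to $1$. For $k,n\ge1$, $\phi(k,n;\Gamma,C)$ is the number of $k\times n$ $(0,1)$-matrices having no $2\times2$ submatrix in $[\Gamma]\cup[C]$. By convention $\phi(0,0;\Gamma,C)=1$ and $\phi(k,0;\Gamma,C)=\phi(0,n;\Gamma,C)=0$ for $k,n\ge1$. The generating functions are $\Phi(x,y;\Gamma,C)=\sum_{n\ge0}\sum_{k\ge0}\phi(k,n;\Gamma,C)\frac{x^k}{k!}\frac{y^n}{n!}$ and $\Phi(z;\Gamma,C)=\sum_{n\ge0}\phi(n,n;\Gamma,C)\frac{z^n}{n!}$. *)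

theory Defs
  imports
    "HOL-Computational_Algebra.Formal_Power_Series"
    "Jordan_Normal_Form.DL_Submatrix"
    "Jordan_Normal_Form.Column_Operations"
begin

definition zero_one_mats :: "nat \<Rightarrow> nat \<Rightarrow> nat mat set" where
  "zero_one_mats k n = {A \<in> carrier_mat k n. \<forall>i<k. \<forall>j<n. A $$ (i, j) \<in> {0, 1}}"

definition Gamma_mat :: "nat mat" where
  "Gamma_mat = mat_of_rows_list 2 [[1, 1], [1, 0]]"

definition C_mat :: "nat mat" where
  "C_mat = mat_of_rows_list 2 [[1, 0], [0, 0]]"

inductive_set exchange_class :: "nat mat \<Rightarrow> nat mat set" for P :: "nat mat" where
  base: "P \<in> exchange_class P"
| rows: "Q \<in> exchange_class P \<Longrightarrow> swaprows 0 1 Q \<in> exchange_class P"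
| cols: "Q \<in> exchange_class P \<Longrightarrow> swapcols 0 1 Q \<in> exchange_class P"

definition submats_2x2 :: "nat mat \<Rightarrow> nat mat set" where
  "submats_2x2 A = {submatrix A {i1, i2} {j1, j2} | i1 i2 j1 j2.
     i1 < i2 \<and> i2 < dim_row A \<and> j1 < j2 \<and> j2 < dim_col A}"

text \<open>The cases \<open>k = 0\<close> or \<open>n = 0\<close> are fixed by convention; counting empty matrices would
  give \<open>1\<close> for \<open>k = 0 < n\<close> and for \<open>n = 0 < k\<close> instead of \<open>0\<close>.\<close>

definition phi :: "nat \<Rightarrow> nat \<Rightarrow> nat mat \<Rightarrow> nat mat \<Rightarrow> nat" where
  "phi k n P Q =
     (if k = 0 \<and> n = 0 then 1
      else if k = 0 \<or> n = 0 then 0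
      else card {A \<in> zero_one_mats k n.
                   submats_2x2 A \<inter> (exchange_class P \<union> exchange_class Q) = {}})"

text \<open>Power series in \<open>x, y\<close> are elements of \<open>real fps fps\<close>, read as \<open>\<real>[[x]][[y]]\<close>: the coefficient
  of \<open>x\<^sup>k y\<^sup>n\<close> in \<open>F\<close> is \<open>fps_nth (fps_nth F n) k\<close>. The maps \<open>in_x\<close> and \<open>in_y\<close> substitute \<open>x\<close>, respectively \<open>y\<close>,
  for the variable of a univariate series.\<close>

definition in_x :: "real fps \<Rightarrow> real fps fps" where
  "in_x f = fps_const f"

definition in_y :: "real fps \<Rightarrow> real fps fps" where
  "in_y f = Abs_fps (\<lambda>n. fps_const (fps_nth f n))"

definition Phi_xy :: "nat mat \<Rightarrow> nat mat \<Rightarrow> real fps fps" where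
  "Phi_xy P Q = Abs_fps (\<lambda>n. Abs_fps (\<lambda>k. real (phi k n P Q) / (fact k * fact n)))"

definition Phi_z :: "nat mat \<Rightarrow> nat mat \<Rightarrow> real fps" where
  "Phi_z P Q = Abs_fps (\<lambda>n. real (phi n n P Q) / fact n)"

end

theory Submission
  imports Defs
begin

text \<open>The eight forbidden \<open>2 \<times> 2\<close> patterns are those with three ones and those with a single one,
  that is, all \<open>2 \<times> 2\<close> zero-one matrices whose entries have an odd sum
  (\<open>in_odd_classes_iff\<close>). So a matrix is counted exactly when \<open>a(i\<^sub>1,j\<^sub>1) + a(i\<^sub>1,j\<^sub>2) +
  a(i\<^sub>2,j\<^sub>1) + a(i\<^sub>2,j\<^sub>2)\<close> is always even. Over the field with two elements this says that
  \<open>a(i,j) = a(0,j) + a(i,0) + a(0,0)\<close>: every row equals the top row or its complement. The top row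
  can be chosen in \<open>2\<^sup>n\<close> ways, and for each of the other \<open>k - 1\<close> rows there is a free choice
  between copying and complementing, which gives \<open>2\<^sup>n \<cdot> 2\<^sup>k\<^sup>-\<^sup>1\<close> matrices (\<open>bij_betw_flip_mat\<close>).

  The two generating functions then follow by comparing coefficients. The conventions for empty
  matrices match the boundary terms: \<open>e\<^sup>2\<^sup>x - 1\<close> and \<open>e\<^sup>2\<^sup>y - 1\<close> have no constant term, so only the
  summand \<open>1\<close> contributes when \<open>k\<close> or \<open>n\<close> vanishes, and in the diagonal series the summand \<open>1\<close>
  corrects the constant term of \<open>e\<^sup>4\<^sup>z / 2\<close> from \<open>1/2\<close> to \<open>1\<close>.\<close>

section \<open>Forbidden patterns are the patterns of odd sum\<close>

definition mat22 :: "'a \<Rightarrow> 'a \<Rightarrow> 'a \<Rightarrow> 'a \<Rightarrow> 'a mat" where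
  "mat22 a b c d = mat 2 2 (\<lambda>(i, j). if i = 0 then (if j = 0 then a else b)
                                        else (if j = 0 then c else d))"

lemma mat22_eq_iff: "mat22 a b c d = mat22 a' b' c' d' \<longleftrightarrow> a = a' \<and> b = b' \<and> c = c' \<and> d = d'"
proof
  assume eq: "mat22 a b c d = mat22 a' b' c' d'"
  have "mat22 a b c d $$ (i, j) = mat22 a' b' c' d' $$ (i, j)" for i j
    using eq by simp
  from this[of 0 0] this[of 0 1] this[of 1 0] this[of 1 1]
  show "a = a' \<and> b = b' \<and> c = c' \<and> d = d'"
    by (simp add: mat22_def)
qed auto

lemma swaprows_mat22: "swaprows 0 1 (mat22 a b c d) = mat22 c d a b"
  by (rule eq_matI) (auto simp: mat22_def)

lemma swapcols_mat22: "swapcols 0 1 (mat22 a b c d) = mat22 b a d c"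
  by (rule eq_matI) (auto simp: mat22_def)

text \<open>The row exchange and the column exchange are commuting involutions, so at most four matrices
  arise.\<close>

lemma exchange_class_mat22:
  "exchange_class (mat22 a b c d) =
     {mat22 a b c d, mat22 c d a b, mat22 b a d c, mat22 d c b a}" (is "?L = ?R")
proof
  have "Q \<in> ?R" if "Q \<in> ?L" for Q
    using that by induction (auto simp: swaprows_mat22 swapcols_mat22 simp del: One_nat_def)
  then show "?L \<subseteq> ?R" by blast
next
  have 1: "mat22 a b c d \<in> ?L" by (rule exchange_class.base)
  have 2: "mat22 c d a b \<in> ?L"
    using exchange_class.rows[OF 1] unfolding swaprows_mat22 .
  have 3: "mat22 b a d c \<in> ?L"
    using exchange_class.cols[OF 1] unfolding swapcols_mat22 .
  have 4: "mat22 d c b a \<in> ?L"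
    using exchange_class.cols[OF 2] unfolding swapcols_mat22 .
  from 1 2 3 4 show "?R \<subseteq> ?L" by blast
qed

lemma Gamma_mat_eq: "Gamma_mat = mat22 1 1 1 0"
  by (rule eq_matI) (auto simp: Gamma_mat_def mat22_def mat_of_rows_list_def less_2_cases_iff)

lemma C_mat_eq: "C_mat = mat22 1 0 0 0"
  by (rule eq_matI) (auto simp: C_mat_def mat22_def mat_of_rows_list_def less_2_cases_iff)

lemma in_odd_classes_iff:
  assumes "a \<in> {0, 1}" "b \<in> {0, 1}" "c \<in> {0, 1}" "d \<in> {0, 1}"
  shows "mat22 a b c d \<in> exchange_class Gamma_mat \<union> exchange_class C_mat \<longleftrightarrow> odd (a + b + c + d)"
  using assms unfolding Gamma_mat_eq C_mat_eq exchange_class_mat22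
  by (auto simp: mat22_eq_iff)

lemma submatrix_pairs:
  assumes "i1 < i2" "i2 < dim_row A" "j1 < j2" "j2 < dim_col A"
  shows "submatrix A {i1, i2} {j1, j2} =
           mat22 (A $$ (i1, j1)) (A $$ (i1, j2)) (A $$ (i2, j1)) (A $$ (i2, j2))"
proof -
  have pick: "pick {a, b} 0 = a" "pick {a, b} (Suc 0) = b" if "a < b" for a b :: nat
  proof -
    show 0: "pick {a, b} 0 = a"
      using that by (auto intro!: Least_equality)
    show "pick {a, b} (Suc 0) = b"
      unfolding pick.simps(2) 0 using that by (auto intro!: Least_equality)
  qed
  have card: "card {i. i < m \<and> i \<in> {a, b}} = 2" if "a < b" "b < m" for a b m :: nat
  proof -
    have "{i. i < m \<and> i \<in> {a, b}} = {a, b}" using that by auto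
    then show ?thesis using that by simp
  qed
  show ?thesis
    unfolding submatrix_def card[OF assms(1,2)] card[OF assms(3,4)] mat22_def
    using pick[OF assms(1)] pick[OF assms(3)]
    by (intro eq_matI) (auto simp: less_2_cases_iff simp del: pick.simps)
qed

lemma avoids_iff_even:
  assumes A: "A \<in> zero_one_mats k n"
  shows "submats_2x2 A \<inter> (exchange_class Gamma_mat \<union> exchange_class C_mat) = {} \<longleftrightarrow>
    (\<forall>i1 i2 j1 j2. i1 < i2 \<longrightarrow> i2 < k \<longrightarrow> j1 < j2 \<longrightarrow> j2 < n \<longrightarrow>
       even (A $$ (i1, j1) + A $$ (i1, j2) + A $$ (i2, j1) + A $$ (i2, j2)))"
proof -
  have dim: "dim_row A = k" "dim_col A = n"
    and ent: "\<And>i j. i < k \<Longrightarrow> j < n \<Longrightarrow> A $$ (i, j) \<in> {0, 1}"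
    using A by (auto simp: zero_one_mats_def)
  have "submatrix A {i1, i2} {j1, j2} \<in> exchange_class Gamma_mat \<union> exchange_class C_mat \<longleftrightarrow>
      odd (A $$ (i1, j1) + A $$ (i1, j2) + A $$ (i2, j1) + A $$ (i2, j2))"
    if "i1 < i2" "i2 < k" "j1 < j2" "j2 < n" for i1 i2 j1 j2
  proof -
    have "i1 < k" "j1 < n" using that by linarith+
    then show ?thesis
      using that dim by (simp only: submatrix_pairs) (intro in_odd_classes_iff ent)
  qed
  then show ?thesis
    unfolding submats_2x2_def dim by blast
qed

section \<open>Counting\<close>

definition flip_mat :: "nat \<Rightarrow> nat \<Rightarrow> nat set \<Rightarrow> nat set \<Rightarrow> nat mat" where
  "flip_mat k n R F = mat k n (\<lambda>(i, j). of_bool ((j \<in> R) \<noteq> (i \<in> F)))"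

text \<open>The row index \<open>0\<close> is kept out of \<open>F\<close>, for otherwise complementing both \<open>R\<close> and \<open>F\<close>
  would give the same matrix. In a matrix without forbidden patterns, the flipped rows are read off from
  column \<open>0\<close>, and the parity condition on rows \<open>0, i\<close> and columns \<open>0, j\<close> determines
  the entry at \<open>(i, j)\<close>.\<close>

lemma bij_betw_flip_mat:
  assumes "k \<ge> 1" "n \<ge> 1"
  shows "bij_betw (\<lambda>(R, F). flip_mat k n R F) (Pow {..<n} \<times> Pow {1..<k})
    {A \<in> zero_one_mats k n.
       submats_2x2 A \<inter> (exchange_class Gamma_mat \<union> exchange_class C_mat) = {}}"
  unfolding bij_betw_def
proof
  show "inj_on (\<lambda>(R, F). flip_mat k n R F) (Pow {..<n} \<times> Pow {1..<k})"
  proof (rule inj_onI, clarify)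
    fix R F R' F'
    assume sub: "R \<subseteq> {..<n}" "F \<subseteq> {1..<k}" "R' \<subseteq> {..<n}" "F' \<subseteq> {1..<k}"
      and eq: "flip_mat k n R F = flip_mat k n R' F'"
    have ent: "((j \<in> R) \<noteq> (i \<in> F)) = ((j \<in> R') \<noteq> (i \<in> F'))" if "i < k" "j < n" for i j
    proof -
      have "flip_mat k n R F $$ (i, j) = flip_mat k n R' F' $$ (i, j)" using eq by simp
      then show ?thesis using that by (simp add: flip_mat_def of_bool_eq_iff del: of_bool_not_iff)
    qed
    have "0 \<notin> F" "0 \<notin> F'" using sub by auto
    then have row: "j \<in> R \<longleftrightarrow> j \<in> R'" if "j < n" for j
      using ent[of 0 j] that assms by simp
    then have "R = R'" using sub by blast
    moreover have "i \<in> F \<longleftrightarrow> i \<in> F'" if "i < k" for i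
      using ent[of i 0] row[of 0] that assms by auto
    then have "F = F'" using sub by (meson atLeastLessThan_iff subset_antisym subset_iff)
    ultimately show "R = R' \<and> F = F'" by simp
  qed
next
  let ?S = "{A \<in> zero_one_mats k n.
       submats_2x2 A \<inter> (exchange_class Gamma_mat \<union> exchange_class C_mat) = {}}"
  show "(\<lambda>(R, F). flip_mat k n R F) ` (Pow {..<n} \<times> Pow {1..<k}) = ?S"
  proof (intro equalityI subsetI)
    fix A assume "A \<in> (\<lambda>(R, F). flip_mat k n R F) ` (Pow {..<n} \<times> Pow {1..<k})"
    then obtain R F where A: "A = flip_mat k n R F" by auto
    have mem: "A \<in> zero_one_mats k n"
      by (auto simp: A flip_mat_def zero_one_mats_def)
    then show "A \<in> ?S"
      by (simp add: avoids_iff_even) (auto simp: A flip_mat_def)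
  next
    fix A assume "A \<in> ?S"
    then have mem: "A \<in> zero_one_mats k n"
      and ev: "\<And>i j. 0 < i \<Longrightarrow> i < k \<Longrightarrow> 0 < j \<Longrightarrow> j < n \<Longrightarrow>
          even (A $$ (0, 0) + A $$ (0, j) + A $$ (i, 0) + A $$ (i, j))"
      using avoids_iff_even[of A k n] by blast+
    have dim: "dim_row A = k" "dim_col A = n"
      and ent: "\<And>i j. i < k \<Longrightarrow> j < n \<Longrightarrow> A $$ (i, j) = 0 \<or> A $$ (i, j) = 1"
      using mem by (auto simp: zero_one_mats_def)
    define R where "R = {j. j < n \<and> A $$ (0, j) = 1}"
    define F where "F = {i. 0 < i \<and> i < k \<and> A $$ (i, 0) \<noteq> A $$ (0, 0)}"
    have "A = flip_mat k n R F"
    proof (rule eq_matI)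
      fix i j assume "i < dim_row (flip_mat k n R F)" "j < dim_col (flip_mat k n R F)"
      then have ij: "i < k" "j < n" by (auto simp: flip_mat_def)
      have "A $$ (i, j) = of_bool ((A $$ (0, j) = 1) \<noteq> (0 < i \<and> A $$ (i, 0) \<noteq> A $$ (0, 0)))"
        using ent[of 0 0] ent[of 0 j] ent[of i 0] ent[of i j] ev[of i j] ij assms
        by (cases "i = 0"; cases "j = 0") auto
      then show "A $$ (i, j) = flip_mat k n R F $$ (i, j)"
        using ij by (simp add: flip_mat_def R_def F_def)
    qed (auto simp: flip_mat_def dim)
    moreover have "R \<in> Pow {..<n}" "F \<in> Pow {1..<k}" by (auto simp: R_def F_def)
    ultimately show "A \<in> (\<lambda>(R, F). flip_mat k n R F) ` (Pow {..<n} \<times> Pow {1..<k})"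
      by blast
  qed
qed

lemma phi_Gamma_C:
  assumes "k \<ge> 1" "n \<ge> 1"
  shows "phi k n Gamma_mat C_mat = 2 ^ (k + n - 1)"
proof -
  have "phi k n Gamma_mat C_mat = card (Pow {..<n} \<times> Pow {1..<k})"
    using assms bij_betw_same_card[OF bij_betw_flip_mat[OF assms]] by (simp add: phi_def)
  also have "\<dots> = 2 ^ n * 2 ^ (k - 1)"
    by (simp add: card_cartesian_product card_Pow)
  also have "\<dots> = 2 ^ (k + n - 1)"
    using assms by (simp flip: power_add)
  finally show ?thesis .
qed

section \<open>Generating functions\<close>

lemma real_phi_Gamma_C:
  assumes "k \<ge> 1" "n \<ge> 1"
  shows "real (phi k n Gamma_mat C_mat) = 1 / 2 * 2 ^ k * 2 ^ n"
proof -
  have "k + n = Suc (k + n - 1)" using assms by simp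
  then have "(2::real) ^ k * 2 ^ n = 2 * 2 ^ (k + n - 1)"
    by (metis power_Suc power_add)
  then show ?thesis using phi_Gamma_C[OF assms] by simp
qed

theorem mainTheorem3:
  shows "(\<forall>k n. k \<ge> 1 \<longrightarrow> n \<ge> 1 \<longrightarrow> phi k n Gamma_mat C_mat = 2 ^ (k + n - 1)) \<and>
    Phi_xy Gamma_mat C_mat =
      1 + fps_const (fps_const (1 / 2)) * (in_x (fps_exp 2) - 1) * (in_y (fps_exp 2) - 1) \<and>
    Phi_z Gamma_mat C_mat = fps_const (1 / 2) * (fps_exp 4 + 1)"
proof (intro conjI)
  show "\<forall>k n. k \<ge> 1 \<longrightarrow> n \<ge> 1 \<longrightarrow> phi k n Gamma_mat C_mat = 2 ^ (k + n - 1)"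
    using phi_Gamma_C by blast
next
  \<comment> \<open>Factors that involve only \<open>x\<close> are constants of \<open>\<real>[[x]][[y]]\<close>; gathering them into one constant
    leaves a scalar multiple of a series in \<open>y\<close>, whose coefficients are immediate.\<close>
  have x_const: "fps_const (fps_const (1 / 2)) * (in_x (fps_exp 2) - 1) =
      fps_const (fps_const (1 / 2) * (fps_exp 2 - 1) :: real fps)"
    unfolding in_x_def fps_const_1_eq_1[symmetric] fps_const_sub fps_const_mult ..
  have y_coeff: "fps_nth (in_y (fps_exp 2) - 1) n = fps_const (if n = 0 then 0 else 2 ^ n / fact n)"
    for n
    by (simp add: in_y_def)
  show "Phi_xy Gamma_mat C_mat =
      1 + fps_const (fps_const (1 / 2)) * (in_x (fps_exp 2) - 1) * (in_y (fps_exp 2) - 1)"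
  proof (intro fps_ext)
    fix n k
    have "fps_nth (fps_nth (Phi_xy Gamma_mat C_mat) n) k =
        (if k = 0 \<and> n = 0 then 1 else if k = 0 \<or> n = 0 then 0
         else 1 / 2 * (2 ^ k / fact k) * (2 ^ n / fact n))"
      by (auto simp: Phi_xy_def real_phi_Gamma_C) (auto simp: phi_def)
    then show "fps_nth (fps_nth (Phi_xy Gamma_mat C_mat) n) k =
        fps_nth (fps_nth (1 + fps_const (fps_const (1 / 2)) * (in_x (fps_exp 2) - 1) *
          (in_y (fps_exp 2) - 1)) n) k"
      unfolding x_const fps_add_nth fps_mult_left_const_nth y_coeff by auto
  qed
  show "Phi_z Gamma_mat C_mat = fps_const (1 / 2) * (fps_exp 4 + 1)"
  proof (rule fps_ext)
    fix n
    have "real (phi n n Gamma_mat C_mat) = 1 / 2 * 4 ^ n" if "n \<ge> 1"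
      using real_phi_Gamma_C[OF that that] by (simp flip: power_mult_distrib)
    then show "fps_nth (Phi_z Gamma_mat C_mat) n = fps_nth (fps_const (1 / 2) * (fps_exp 4 + 1)) n"
      by (cases "n = 0") (auto simp: Phi_z_def phi_def[of 0] field_simps)
  qed
qed

end
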